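(* Fix $1<c<\infty$ and $0<s<\infty$, and for each $d\in\mathbb{N}$ let $0<q<1$ ($q=q(d)$) be such that $q\ge 2^{-o(d)}$. Then for a certain choice of $r=\omega_d(1)$ (depending on $d$, $c$, $s$, $q$) every symmetric $(r,cr,p_1,p_2,p_q,p_u)$-sensitive filter family for $\ell_s^d$ with $p_2/p_q=q$ must satisfy $$\frac{\log(p_q/p_1)}{\log(p_q/p_2)}\ \ge\ \frac{1}{c^s}-o_d(1).$$
   Context: $\ell_s^d$ denotes $\mathbb{R}^d$ with $D(\mathbf{x},\mathbf{y})=\|\mathbf{x}-\mathbf{y}\|_s=\left(\sum_{i=1}^d|x_i-y_i|^s\right)^{1/s}$. A filter family for a space $(X,D)$ is a probability distribution $\mathcal{F}$ over pairs $(Q,U)$ with $Q,U\subseteq X$. It is $(r,cr,p_1,p_2,p_q,p_u)$-sensitive if for all $\mathbf{x},\mathbf{y}\in X$ and $(Q,U)\sim\mathcal{F}$: (i) if $D(\mathbf{x},\mathbf{y})\le r$ then $\Pr[\mathbf{x}\in Q,\mathbf{y}\in U]\ge p_1$; (ii) if $D(\mathbf{x},\mathbf{y})>cr$ then $\Pr[\mathbf{x}\in Q,\mathbf{y}\in U]\le p_2$; (iii) $\Pr[\mathbf{x}\in Q]\le p_q$ and $\Pr[\mathbf{x}\in U]\le p_u$. It is implicit that $p_q,p_u>p_1>p_2>0$. The family is symmetric if $Q=U$ for every filter $(Q,U)$ in the family. The notation $o_d(1)$ (resp. $\omega_d(1)$, $o(d)$) refers to $d\to\infty$: a quantity tending to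 $0$ (resp. tending to infinity, being of lower order than $d$). *)

theory Defs
  imports "HOL-Probability.Probability" "HOL-Library.Landau_Symbols"
begin

text \<open>
  Since \<open>d\<close> tends to infinity inside a single statement, \<open>d\<close>-dimensional real space is carried by
  the extensional functions on \<open>{..<d}\<close>. For \<open>s < 1\<close> the function \<open>ell_dist s d\<close> is not a metric.
\<close>

definition ell_space :: "nat \<Rightarrow> (nat \<Rightarrow> real) set" where
  "ell_space d = ({..<d} \<rightarrow>\<^sub>E UNIV)"

definition ell_dist :: "real \<Rightarrow> nat \<Rightarrow> (nat \<Rightarrow> real) \<Rightarrow> (nat \<Rightarrow> real) \<Rightarrow> real" where
  "ell_dist s d x y = (\<Sum>i<d. \<bar>x i - y i\<bar> powr s) powr (1 / s)"

text \<open>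
  A probability distribution over pairs \<open>(Q, U)\<close> of subsets of \<open>X\<close>. The sigma-algebra is arbitrary,
  except that the membership events occurring in the definition of sensitivity have to be
  measurable (the joint events \<open>x \<in> Q, y \<in> U\<close> then are as well).
\<close>

locale filter_family = prob_space F
  for X :: "'a set" and F :: "('a set \<times> 'a set) measure" +
  assumes space_subset: "space F \<subseteq> Pow X \<times> Pow X"
    and query_event: "x \<in> X \<Longrightarrow> {(Q, U) \<in> space F. x \<in> Q} \<in> sets F"
    and update_event: "x \<in> X \<Longrightarrow> {(Q, U) \<in> space F. x \<in> U} \<in> sets F"

text \<open>In \<open>sensitive_family\<close>, \<open>R\<close> is the far threshold, written \<open>cr\<close> in the literature.\<close>

definition sensitive_family ::
  "'a set \<Rightarrow> ('a \<Rightarrow> 'a \<Rightarrow> real) \<Rightarrow> ('a set \<times> 'a set) measure \<Rightarrow>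
   real \<Rightarrow> real \<Rightarrow> real \<Rightarrow> real \<Rightarrow> real \<Rightarrow> real \<Rightarrow> bool" where
  "sensitive_family X D F r R p\<^sub>1 p\<^sub>2 p\<^sub>q p\<^sub>u \<longleftrightarrow>
     filter_family X F \<and>
     (\<forall>x\<in>X. \<forall>y\<in>X.
        (D x y \<le> r \<longrightarrow> measure F {(Q, U) \<in> space F. x \<in> Q \<and> y \<in> U} \<ge> p\<^sub>1) \<and>
        (D x y > R \<longrightarrow> measure F {(Q, U) \<in> space F. x \<in> Q \<and> y \<in> U} \<le> p\<^sub>2)) \<and>
     (\<forall>x\<in>X.
        measure F {(Q, U) \<in> space F. x \<in> Q} \<le> p\<^sub>q \<and>
        measure F {(Q, U) \<in> space F. x \<in> U} \<le> p\<^sub>u) \<and>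
     p\<^sub>q > p\<^sub>1 \<and> p\<^sub>u > p\<^sub>1 \<and> p\<^sub>1 > p\<^sub>2 \<and> p\<^sub>2 > 0"

text \<open>
  Equality is required up to a null set, so that the notion depends on the distribution and not
  on which irrelevant pairs belong to \<open>space F\<close>; it holds in particular if \<open>Q = U\<close> on all of
  \<open>space F\<close>.
\<close>

definition symmetric_family :: "('a set \<times> 'a set) measure \<Rightarrow> bool" where
  "symmetric_family F \<longleftrightarrow> (AE (Q, U) in F. Q = U)"

end

theory Submission
  imports Defs "HOL-Real_Asymp.Real_Asymp"
begin

text \<open>
  Restrict the family to the cube \<open>{0, 1}\<^sup>d\<close>, on which \<open>\<parallel>x - y\<parallel>\<close> is the \<open>s\<close>-th root of the Hamming
  distance, and let \<open>\<kappa>(x, y) = Pr[x, y \<in> Q]\<close>. This kernel is positive semidefinite, so the average of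
  \<open>\<kappa>\<close> over pairs \<open>(x, y)\<close>, where \<open>y\<close> is \<open>x\<close> with each coordinate flipped with probability \<open>\<eta>\<close>, is
  \<open>\<Sum>\<^sub>S c\<^sub>S (1 - 2\<eta>)\<^bsup>|S|\<^esup>\<close> with \<open>c\<^sub>S \<ge> 0\<close>. By convexity of \<open>t\<^sup>C\<close> its \<open>C\<close>-th power is at most \<open>p\<^sub>q\<^bsup>C-1\<^esup>\<close>
  times the average at the rate \<open>\<eta>'\<close> with \<open>1 - 2\<eta>' = (1 - 2\<eta>)\<^sup>C\<close>, which is about \<open>C\<eta>\<close>. For \<open>C\<close> slightly above
  \<open>c\<^sup>s\<close>, Hoeffding's inequality puts the \<open>\<eta>\<close>-noisy pairs within distance \<open>r\<close> and the
  \<open>\<eta>'\<close>-noisy ones beyond \<open>cr\<close>, whence \<open>p\<^sub>1\<^sup>C \<lesssim> p\<^sub>q\<^bsup>C-1\<^esup> p\<^sub>2\<close>.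

  If \<open>q\<close> is close to \<open>1\<close> the errors would swamp \<open>ln (1 / q)\<close>. The ratio of logarithms does not
  change when all probabilities are raised to the power \<open>n\<close>, and \<open>\<kappa>\<^sup>n\<close> is again positive semidefinite
  (Schur), so one may work with \<open>q\<^sup>n \<le> 1/2\<close> instead.
\<close>

section \<open>Walsh expansion of noise stability on the cube\<close>

definition symdiff :: "'a set \<Rightarrow> 'a set \<Rightarrow> 'a set" where
  "symdiff A B = (A - B) \<union> (B - A)"

text \<open>Cube points are coded as subsets, so flipping the coordinates in \<open>D\<close> is
  \<open>symdiff A D\<close>. For finite \<open>S\<close>, \<open>walsh S\<close> is the character
  of this group with index \<open>S\<close>, a sign given by the parity of the intersection of
  \<open>S\<close> and \<open>A\<close>.\<close>

definition walsh :: "'a set \<Rightarrow> 'a set \<Rightarrow> real" where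
  "walsh S A = (\<Prod>i\<in>S. if i \<in> A then - 1 else 1)"

text \<open>For finite \<open>I\<close> and \<open>D \<subseteq> I\<close>, the probability that
  independent flips at rate \<eta> hit exactly the coordinates in \<open>D\<close>.\<close>

definition flip_weight :: "'a set \<Rightarrow> real \<Rightarrow> 'a set \<Rightarrow> real" where
  "flip_weight I \<eta> D = \<eta> ^ card D * (1 - \<eta>) ^ (card I - card D)"

text \<open>For a kernel of the form \<open>f A * f B\<close> this is the classical noise stability
  of \<open>f\<close> at correlation \<open>1 - 2 * \<eta>\<close>.\<close>

definition noise_stability :: "'a set \<Rightarrow> ('a set \<Rightarrow> 'a set \<Rightarrow> real) \<Rightarrow> real \<Rightarrow> real" where
  "noise_stability I \<kappa> \<eta> =
     (\<Sum>A\<in>Pow I. \<Sum>D\<in>Pow I. flip_weight I \<eta> D * \<kappa> A (symdiff A D)) / 2 ^ card I"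

definition psd_on :: "'a set \<Rightarrow> ('a \<Rightarrow> 'a \<Rightarrow> real) \<Rightarrow> bool" where
  "psd_on Y \<kappa> \<longleftrightarrow> (\<forall>a. 0 \<le> (\<Sum>x\<in>Y. \<Sum>y\<in>Y. a x * a y * \<kappa> x y))"

lemma symdiff_symdiff [simp]: "symdiff A (symdiff A B) = B"
  by (auto simp: symdiff_def)

lemma walsh_symdiff: "walsh S (symdiff A B) = walsh S A * walsh S B"
  unfolding walsh_def symdiff_def prod.distrib [symmetric] by (intro prod.cong) auto

text \<open>The weight is a product over the coordinates; each factor, \<eta> or
  \<open>1 - \<eta>\<close>, is half of 1 plus \<open>1 - 2 * \<eta>\<close> times a sign.
  Multiplying out yields one term per subset.\<close>

lemma flip_weight_walsh:
  assumes I: "finite I" and D: "D \<subseteq> I"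
  shows "flip_weight I \<eta> D = (\<Sum>S\<in>Pow I. (1 - 2 * \<eta>) ^ card S * walsh S D) / 2 ^ card I"
proof -
  have "(\<Sum>S\<in>Pow I. (1 - 2 * \<eta>) ^ card S * walsh S D) =
      (\<Sum>S\<in>Pow I. (\<Prod>i\<in>S. (1 - 2 * \<eta>) * (if i \<in> D then - 1 else 1)) * (\<Prod>i\<in>I - S. 1))"
    by (simp add: walsh_def prod.distrib)
  also have "\<dots> = (\<Prod>i\<in>I. (1 - 2 * \<eta>) * (if i \<in> D then - 1 else 1) + 1)"
    by (rule prod_add [symmetric, OF I])
  also have "\<dots> = (\<Prod>i\<in>I. if i \<in> D then 2 * \<eta> else 2 * (1 - \<eta>))"
    by (intro prod.cong) (auto simp: algebra_simps)
  also have "\<dots> = (2 * \<eta>) ^ card D * (2 * (1 - \<eta>)) ^ (card I - card D)"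
  proof -
    have "I \<inter> {i. i \<in> D} = D" "I \<inter> - {i. i \<in> D} = I - D"
      using D by auto
    then show ?thesis
      using I D by (simp add: prod.If_cases card_Diff_subset finite_subset)
  qed
  also have "\<dots> = 2 ^ (card D + (card I - card D)) * flip_weight I \<eta> D"
    unfolding flip_weight_def power_mult_distrib power_add by (simp only: mult_ac)
  also have "card D + (card I - card D) = card I"
    using card_mono [OF I D] by simp
  finally show ?thesis
    by simp
qed

text \<open>Noise is diagonal in the characters, with eigenvalue
  \<open>(1 - 2 * \<eta>) ^ card S\<close>. The coefficients do not depend on \<eta>, and each is
  the quadratic form of \<kappa> at the vector \<open>walsh S\<close>, scaled, hence nonnegative for
  a positive semidefinite kernel.\<close>

lemma noise_stability_walsh:
  assumes I: "finite I"
  shows "noise_stability I \<kappa> \<eta> =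
    (\<Sum>S\<in>Pow I. ((\<Sum>A\<in>Pow I. \<Sum>B\<in>Pow I. walsh S A * walsh S B * \<kappa> A B) / 4 ^ card I)
      * (1 - 2 * \<eta>) ^ card S)"
proof -
  \<comment> \<open>Substitute \<open>B = symdiff A D\<close>, an involution in \<open>D\<close>;
    then \<open>walsh S D\<close> splits as \<open>walsh S A * walsh S B\<close>.\<close>
  have "(\<Sum>D\<in>Pow I. flip_weight I \<eta> D * \<kappa> A (symdiff A D)) =
      (\<Sum>B\<in>Pow I. (\<Sum>S\<in>Pow I. (1 - 2 * \<eta>) ^ card S * (walsh S A * walsh S B)) / 2 ^ card I * \<kappa> A B)"
    if "A \<in> Pow I" for A
    using that
    by (intro sum.reindex_bij_witness [of _ "symdiff A" "symdiff A"])
      (auto simp: symdiff_def flip_weight_walsh [OF I] simp flip: walsh_symdiff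
            intro!: arg_cong2 [of _ _ _ _ walsh] sum.cong arg_cong2 [of _ _ _ _ "(*)"]
              arg_cong2 [of _ _ _ _ "(/)"])
  moreover have "(4 :: real) ^ card I = 2 ^ card I * 2 ^ card I"
    by (simp flip: power_mult_distrib)
  ultimately have "noise_stability I \<kappa> \<eta> =
      (\<Sum>A\<in>Pow I. \<Sum>B\<in>Pow I. \<Sum>S\<in>Pow I.
        (1 - 2 * \<eta>) ^ card S * (walsh S A * walsh S B) * \<kappa> A B) / 4 ^ card I"
    by (simp add: noise_stability_def sum_distrib_right sum_divide_distrib mult.assoc)
  also have "(\<Sum>A\<in>Pow I. \<Sum>B\<in>Pow I. \<Sum>S\<in>Pow I.
        (1 - 2 * \<eta>) ^ card S * (walsh S A * walsh S B) * \<kappa> A B) =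
      (\<Sum>S\<in>Pow I. \<Sum>A\<in>Pow I. \<Sum>B\<in>Pow I.
        (1 - 2 * \<eta>) ^ card S * (walsh S A * walsh S B) * \<kappa> A B)"
    by (subst sum.swap) (intro sum.cong refl sum.swap)
  finally show ?thesis
    by (simp add: sum_distrib_left sum_distrib_right sum_divide_distrib mult_ac)
qed

text \<open>At rate 0 only the empty flip set has positive weight. Since all eigenvalues are 1
  there, this computes the sum of the Walsh coefficients.\<close>

lemma noise_stability_0:
  assumes I: "finite I"
  shows "noise_stability I \<kappa> 0 = (\<Sum>A\<in>Pow I. \<kappa> A A) / 2 ^ card I"
proof -
  have "(\<Sum>D\<in>Pow I. flip_weight I 0 D * \<kappa> A (symdiff A D)) = \<kappa> A A" for A
  proof -
    have "(\<Sum>D\<in>Pow I. flip_weight I 0 D * \<kappa> A (symdiff A D)) =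
        (\<Sum>D\<in>{{}}. flip_weight I 0 D * \<kappa> A (symdiff A D))"
      using I by (intro sum.mono_neutral_right)
        (auto simp: flip_weight_def card_gt_0_iff finite_subset power_0_left)
    then show ?thesis
      by (simp add: flip_weight_def symdiff_def)
  qed
  then show ?thesis
    by (simp add: noise_stability_def)
qed

section \<open>Comparing noise stability at two rates\<close>

lemma weighted_power_mean:
  fixes w x :: "'a \<Rightarrow> real"
  assumes "finite T" and w: "\<And>i. i \<in> T \<Longrightarrow> 0 \<le> w i" and x: "\<And>i. i \<in> T \<Longrightarrow> 0 < x i"
    and C: "1 \<le> C" and P: "(\<Sum>i\<in>T. w i) \<le> P"
  shows "(\<Sum>i\<in>T. w i * x i) powr C \<le> P powr (C - 1) * (\<Sum>i\<in>T. w i * x i powr C)"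
proof -
  define W where "W = (\<Sum>i\<in>T. w i)"
  have "W \<ge> 0"
    unfolding W_def by (intro sum_nonneg w)
  have nonneg: "(\<Sum>i\<in>T. w i * x i powr C) \<ge> 0"
    by (intro sum_nonneg mult_nonneg_nonneg w) auto
  show ?thesis
  proof (cases "W = 0")
    case True
    then have "\<forall>i\<in>T. w i = 0"
      unfolding W_def using sum_nonneg_eq_0_iff [OF \<open>finite T\<close>, of w] w by auto
    then show ?thesis
      by simp
  next
    case False
    with \<open>W \<ge> 0\<close> have W: "W > 0"
      by simp
    then have "T \<noteq> {}"
      by (auto simp: W_def)
    \<comment> \<open>Jensen's inequality for the normalised weights. Undoing the normalisation
      leaves \<open>W powr (C - 1)\<close>, which is monotone in \<open>W\<close> because
      \<open>C \<ge> 1\<close>.\<close>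
    have "(\<Sum>i\<in>T. (w i / W) *\<^sub>R x i) powr C \<le> (\<Sum>i\<in>T. (w i / W) * x i powr C)"
    proof (rule convex_on_sum [OF \<open>finite T\<close> \<open>T \<noteq> {}\<close> powr_convex [OF C]])
      show "(\<Sum>i\<in>T. w i / W) = 1"
        using W by (simp add: W_def flip: sum_divide_distrib)
    qed (use w x W in auto)
    then have "((\<Sum>i\<in>T. w i * x i) / W) powr C \<le> (\<Sum>i\<in>T. w i * x i powr C) / W"
      by (simp add: sum_divide_distrib)
    moreover have "(\<Sum>i\<in>T. w i * x i) \<ge> 0"
      using x by (intro sum_nonneg mult_nonneg_nonneg w) (auto intro: less_imp_le)
    ultimately have "(\<Sum>i\<in>T. w i * x i) powr C \<le> W powr (C - 1) * (\<Sum>i\<in>T. w i * x i powr C)"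
      using W by (simp add: powr_divide powr_diff field_simps)
    also have "\<dots> \<le> P powr (C - 1) * (\<Sum>i\<in>T. w i * x i powr C)"
      using P C W nonneg by (intro mult_right_mono powr_mono2) (auto simp: W_def)
    finally show ?thesis .
  qed
qed

text \<open>The coefficients sum to the average of the diagonal, so to at most \<open>P\<close>, and
  the eigenvalue at \<eta>' is the \<open>C\<close>-th power of the one at \<eta>. The power mean
  inequality applies to the two Walsh expansions.\<close>

lemma noise_stability_powr_le:
  assumes I: "finite I" and psd: "psd_on (Pow I) \<kappa>"
    and diag: "\<And>A. A \<subseteq> I \<Longrightarrow> \<kappa> A A \<le> P"
    and C: "1 \<le> C" and \<eta>: "\<eta> < 1 / 2" and \<eta>': "1 - 2 * \<eta>' = (1 - 2 * \<eta>) powr C"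
  shows "noise_stability I \<kappa> \<eta> powr C \<le> P powr (C - 1) * noise_stability I \<kappa> \<eta>'"
proof -
  define w where "w S = (\<Sum>A\<in>Pow I. \<Sum>B\<in>Pow I. walsh S A * walsh S B * \<kappa> A B) / 4 ^ card I"
    for S :: "'a set"
  have w: "w S \<ge> 0" for S
    using psd unfolding w_def psd_on_def by simp
  have "(\<Sum>S\<in>Pow I. w S) = noise_stability I \<kappa> 0"
    unfolding noise_stability_walsh [OF I] w_def by simp
  also have "\<dots> \<le> (\<Sum>A\<in>Pow I. P) / 2 ^ card I"
    unfolding noise_stability_0 [OF I] using diag by (intro divide_right_mono sum_mono) auto
  also have "\<dots> = P"
    using I by (simp add: card_Pow)
  finally have "(\<Sum>S\<in>Pow I. w S * (1 - 2 * \<eta>) ^ card S) powr C \<le>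
      P powr (C - 1) * (\<Sum>S\<in>Pow I. w S * ((1 - 2 * \<eta>) ^ card S) powr C)"
    using I w \<eta> C by (intro weighted_power_mean) auto
  moreover have "((1 - 2 * \<eta>) ^ n) powr C = (1 - 2 * \<eta>') ^ n" for n
    using \<eta> unfolding \<eta>' by (simp add: powr_powr mult.commute flip: powr_realpow)
  ultimately show ?thesis
    by (simp add: noise_stability_walsh [OF I] w_def)
qed

section \<open>Noise stability bounded through binomial tails\<close>

lemma flip_weight_nonneg: "0 \<le> \<eta> \<Longrightarrow> \<eta> \<le> 1 \<Longrightarrow> 0 \<le> flip_weight I \<eta> D"
  by (simp add: flip_weight_def)

text \<open>The number of flipped coordinates is binomial: group the flip sets by
  cardinality.\<close>

lemma sum_flip_weight:
  assumes I: "finite I" and \<eta>: "0 \<le> \<eta>" "\<eta> \<le> 1"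
  shows "(\<Sum>D\<in>{D\<in>Pow I. card D \<in> K}. flip_weight I \<eta> D) =
    measure_pmf.prob (binomial_pmf (card I) \<eta>) K"
proof -
  let ?n = "card I"
  have "(\<Sum>D\<in>{D\<in>Pow I. card D \<in> K}. flip_weight I \<eta> D) =
      (\<Sum>k\<in>K \<inter> {..?n}. \<Sum>D\<in>{D. D \<in> {D\<in>Pow I. card D \<in> K} \<and> card D = k}. flip_weight I \<eta> D)"
    using I by (intro sum.group [symmetric]) (auto intro: card_mono)
  also have "\<dots> = (\<Sum>k\<in>K \<inter> {..?n}. pmf (binomial_pmf ?n \<eta>) k)"
  proof (rule sum.cong [OF refl])
    fix k assume k: "k \<in> K \<inter> {..?n}"
    have "(\<Sum>D\<in>{D. D \<in> {D\<in>Pow I. card D \<in> K} \<and> card D = k}. flip_weight I \<eta> D) =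
        (\<Sum>D\<in>{D. D \<subseteq> I \<and> card D = k}. \<eta> ^ k * (1 - \<eta>) ^ (?n - k))"
      using k by (intro sum.cong) (auto simp: flip_weight_def)
    then show "(\<Sum>D\<in>{D. D \<in> {D\<in>Pow I. card D \<in> K} \<and> card D = k}. flip_weight I \<eta> D) =
        pmf (binomial_pmf ?n \<eta>) k"
      using \<eta> by (simp add: n_subsets [OF I])
  qed
  also have "\<dots> = measure_pmf.prob (binomial_pmf ?n \<eta>) (K \<inter> {..?n})"
    by (simp add: measure_measure_pmf_finite)
  also have "\<dots> = measure_pmf.prob (binomial_pmf ?n \<eta>) K"
    using \<eta> by (intro measure_pmf.finite_measure_eq_AE)
      (auto simp: AE_measure_pmf_iff set_pmf_binomial_eq split: if_splits)
  finally show ?thesis .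
qed

text \<open>Flip sets of size outside \<open>K\<close> contribute nonnegative terms and are
  dropped.\<close>

lemma noise_stability_ge:
  assumes I: "finite I" and \<eta>: "0 \<le> \<eta>" "\<eta> \<le> 1" and p: "0 \<le> p"
    and nonneg: "\<And>A B. A \<subseteq> I \<Longrightarrow> B \<subseteq> I \<Longrightarrow> 0 \<le> \<kappa> A B"
    and near: "\<And>A D. A \<subseteq> I \<Longrightarrow> D \<subseteq> I \<Longrightarrow> card D \<in> K \<Longrightarrow> p \<le> \<kappa> A (symdiff A D)"
  shows "p * measure_pmf.prob (binomial_pmf (card I) \<eta>) K \<le> noise_stability I \<kappa> \<eta>"
proof -
  have "(\<Sum>D\<in>{D\<in>Pow I. card D \<in> K}. flip_weight I \<eta> D) * p \<le>
      (\<Sum>D\<in>Pow I. flip_weight I \<eta> D * \<kappa> A (symdiff A D))" if A: "A \<in> Pow I" for A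
  proof -
    have "(\<Sum>D\<in>{D\<in>Pow I. card D \<in> K}. flip_weight I \<eta> D) * p \<le>
        (\<Sum>D\<in>{D\<in>Pow I. card D \<in> K}. flip_weight I \<eta> D * \<kappa> A (symdiff A D))"
      unfolding sum_distrib_right using A \<eta> near
      by (intro sum_mono mult_left_mono flip_weight_nonneg) auto
    also have "\<dots> \<le> (\<Sum>D\<in>Pow I. flip_weight I \<eta> D * \<kappa> A (symdiff A D))"
      using A \<eta> I by (intro sum_mono2 mult_nonneg_nonneg flip_weight_nonneg nonneg)
        (auto simp: symdiff_def)
    finally show ?thesis .
  qed
  then have "(\<Sum>A\<in>Pow I. measure_pmf.prob (binomial_pmf (card I) \<eta>) K * p) / 2 ^ card I \<le>
      noise_stability I \<kappa> \<eta>"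
    unfolding noise_stability_def sum_flip_weight [OF I \<eta>]
    by (intro divide_right_mono sum_mono) auto
  then show ?thesis
    using I by (simp add: card_Pow mult.commute)
qed

lemma noise_stability_le:
  assumes I: "finite I" and \<eta>: "0 \<le> \<eta>" "\<eta> \<le> 1" and p: "0 \<le> p"
    and bound: "\<And>A B. A \<subseteq> I \<Longrightarrow> B \<subseteq> I \<Longrightarrow> \<kappa> A B \<le> P"
    and far: "\<And>A D. A \<subseteq> I \<Longrightarrow> D \<subseteq> I \<Longrightarrow> card D \<notin> K \<Longrightarrow> \<kappa> A (symdiff A D) \<le> p"
  shows "noise_stability I \<kappa> \<eta> \<le> p + P * measure_pmf.prob (binomial_pmf (card I) \<eta>) K"
proof -
  \<comment> \<open>The bound \<open>p\<close> is charged to every flip set, and \<open>P\<close> in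
    addition to those of size in \<open>K\<close>. The condition \<open>card D \<in> UNIV\<close>
    brings the total weight into the form of \<open>sum_flip_weight\<close>, which evaluates it to
    1.\<close>
  have "(\<Sum>D\<in>Pow I. flip_weight I \<eta> D * \<kappa> A (symdiff A D)) \<le>
      (\<Sum>D\<in>{D\<in>Pow I. card D \<in> UNIV}. flip_weight I \<eta> D) * p
        + (\<Sum>D\<in>{D\<in>Pow I. card D \<in> K}. flip_weight I \<eta> D) * P" if A: "A \<in> Pow I" for A
  proof -
    have "(\<Sum>D\<in>Pow I. flip_weight I \<eta> D * \<kappa> A (symdiff A D)) \<le>
        (\<Sum>D\<in>Pow I. flip_weight I \<eta> D * p + (if card D \<in> K then flip_weight I \<eta> D * P else 0))"
    proof (rule sum_mono)
      fix D assume D: "D \<in> Pow I"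
      have w: "0 \<le> flip_weight I \<eta> D"
        using \<eta> by (rule flip_weight_nonneg)
      have "\<kappa> A (symdiff A D) \<le> P"
        using A D by (intro bound) (auto simp: symdiff_def)
      then show "flip_weight I \<eta> D * \<kappa> A (symdiff A D) \<le>
          flip_weight I \<eta> D * p + (if card D \<in> K then flip_weight I \<eta> D * P else 0)"
        using far [of A D] A D w p
        by (auto intro: mult_left_mono order_trans [OF mult_left_mono])
    qed
    also have "\<dots> = (\<Sum>D\<in>{D\<in>Pow I. card D \<in> UNIV}. flip_weight I \<eta> D) * p
        + (\<Sum>D\<in>{D\<in>Pow I. card D \<in> K}. flip_weight I \<eta> D) * P"
      using I by (simp add: sum.distrib sum_distrib_right Pow_def flip: sum.inter_filter)
    finally show ?thesis .
  qed
  then have "noise_stability I \<kappa> \<eta> \<le>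
      (\<Sum>A\<in>Pow I. p + P * measure_pmf.prob (binomial_pmf (card I) \<eta>) K) / 2 ^ card I"
    unfolding noise_stability_def sum_flip_weight [OF I \<eta>]
    by (intro divide_right_mono sum_mono) (auto simp: mult.commute)
  then show ?thesis
    using I by (simp add: card_Pow)
qed

section \<open>Powers of the joint membership kernel\<close>

lemma (in prob_space) psd_on_prob_power:
  assumes Y: "finite Y" and E: "\<And>x. x \<in> Y \<Longrightarrow> E x \<in> events"
  shows "psd_on Y (\<lambda>x y. prob (E x \<inter> E y) ^ n)"
proof (induction n)
  case 0
  have "(\<Sum>x\<in>Y. \<Sum>y\<in>Y. a x * a y) = (\<Sum>x\<in>Y. a x)\<^sup>2" for a :: "'b \<Rightarrow> real"
    by (simp add: power2_eq_square sum_product)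
  then show ?case
    by (simp add: psd_on_def)
next
  case (Suc n)
  let ?k = "\<lambda>x y. prob (E x \<inter> E y) ^ n"
  show ?case
    unfolding psd_on_def
  proof
    fix a :: "'b \<Rightarrow> real"
    \<comment> \<open>Schur product argument: one more factor \<open>prob (E x \<inter> E y)\<close>
      arises by averaging over \<omega> the form of the \<open>n\<close>-th power, its coefficients
      restricted to the events that contain \<omega>.\<close>
    let ?f = "\<lambda>\<omega> x. a x * indicator (E x) \<omega>"
    have "0 \<le> (\<Sum>x\<in>Y. \<Sum>y\<in>Y. ?f \<omega> x * ?f \<omega> y * ?k x y)" for \<omega>
      by (rule spec [OF Suc [unfolded psd_on_def], where x = "?f \<omega>"])
    then have "0 \<le> (\<integral>\<omega>. (\<Sum>x\<in>Y. \<Sum>y\<in>Y. ?f \<omega> x * ?f \<omega> y * ?k x y) \<partial>M)"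
      by (rule Bochner_Integration.integral_nonneg)
    also have "\<dots> = (\<integral>\<omega>. (\<Sum>x\<in>Y. \<Sum>y\<in>Y. (a x * a y * ?k x y) * indicator (E x \<inter> E y) \<omega>) \<partial>M)"
      by (simp add: indicator_inter_arith mult_ac)
    also have "\<dots> = (\<Sum>x\<in>Y. \<Sum>y\<in>Y. \<integral>\<omega>. (a x * a y * ?k x y) * indicator (E x \<inter> E y) \<omega> \<partial>M)"
      using E by (subst Bochner_Integration.integral_sum)
        (auto intro!: Bochner_Integration.integrable_sum sum.cong integrable_mult_right
          integrable_real_indicator Bochner_Integration.integral_sum
          simp: less_top [symmetric] emeasure_finite)
    also have "\<dots> = (\<Sum>x\<in>Y. \<Sum>y\<in>Y. a x * a y * prob (E x \<inter> E y) ^ Suc n)"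
      using E by (intro sum.cong refl) (simp add: mult_ac Int_absorb2 sets.sets_into_space le_infI1)
    finally show "0 \<le> (\<Sum>x\<in>Y. \<Sum>y\<in>Y. a x * a y * prob (E x \<inter> E y) ^ Suc n)" .
  qed
qed

section \<open>The cube inside the space, and the inequality for sensitive families\<close>

definition cube_point :: "nat \<Rightarrow> nat set \<Rightarrow> nat \<Rightarrow> real" where
  "cube_point d A = (\<lambda>i\<in>{..<d}. if i \<in> A then 1 else 0)"

lemma cube_point_in_ell_space [simp]: "cube_point d A \<in> ell_space d"
  by (simp add: cube_point_def ell_space_def)

lemma ell_dist_cube_point:
  assumes "A \<subseteq> {..<d}" "B \<subseteq> {..<d}"
  shows "ell_dist s d (cube_point d A) (cube_point d B) = real (card (symdiff A B)) powr (1 / s)"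
proof -
  have "(\<Sum>i<d. \<bar>cube_point d A i - cube_point d B i\<bar> powr s) =
      (\<Sum>i\<in>{..<d}. if i \<in> symdiff A B then 1 else 0)"
    by (intro sum.cong) (auto simp: cube_point_def symdiff_def)
  also have "\<dots> = real (card ({..<d} \<inter> symdiff A B))"
    by (simp add: sum.If_cases)
  also have "{..<d} \<inter> symdiff A B = symdiff A B"
    using assms by (auto simp: symdiff_def)
  finally show ?thesis
    by (simp add: ell_dist_def)
qed

text \<open>The two-rate inequality for the \<open>n\<close>-th power of the joint membership
  kernel: near pairs bound its left side from below, far pairs its right side from above, and no
  entry exceeds \<open>p\<^sub>q ^ n\<close>.\<close>

lemma sensitive_family_noise_bound:
  assumes sens: "sensitive_family (ell_space d) (ell_dist s d) F r R p\<^sub>1 p\<^sub>2 p\<^sub>q p\<^sub>u"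
    and symm: "symmetric_family F"
    and C: "1 \<le> C" and \<eta>: "0 \<le> \<eta>" "\<eta> < 1 / 2" and \<eta>': "1 - 2 * \<eta>' = (1 - 2 * \<eta>) powr C"
  shows "(p\<^sub>1 ^ n * measure_pmf.prob (binomial_pmf d \<eta>) {k. real k powr (1 / s) \<le> r}) powr C \<le>
    (p\<^sub>q ^ n) powr (C - 1) *
      (p\<^sub>2 ^ n + p\<^sub>q ^ n * measure_pmf.prob (binomial_pmf d \<eta>') {k. real k powr (1 / s) \<le> R})"
proof -
  interpret filter_family "ell_space d" F
    using sens by (simp add: sensitive_family_def)
  let ?I = "{..<d}"
  define E where "E A = {(Q, U) \<in> space F. cube_point d A \<in> Q}" for A
  define \<kappa> where "\<kappa> A B = prob (E A \<inter> E B) ^ n" for A B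
  have E [measurable]: "E A \<in> events" for A
    unfolding E_def by (rule query_event) simp
  \<comment> \<open>Symmetry enters here: up to a null set \<open>U\<close> may be replaced by
    \<open>Q\<close>, which makes the kernel a Gram kernel of indicators.\<close>
  have joint: "prob {(Q, U) \<in> space F. cube_point d A \<in> Q \<and> cube_point d B \<in> U} = prob (E A \<inter> E B)"
    for A B
  proof (rule finite_measure_eq_AE)
    show "AE x in F. x \<in> {(Q, U) \<in> space F. cube_point d A \<in> Q \<and> cube_point d B \<in> U} \<longleftrightarrow>
        x \<in> E A \<inter> E B"
      using symm unfolding symmetric_family_def by eventually_elim (auto simp: E_def)
    have "{(Q, U) \<in> space F. cube_point d A \<in> Q \<and> cube_point d B \<in> U} =
        E A \<inter> {(Q, U) \<in> space F. cube_point d B \<in> U}"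
      by (auto simp: E_def)
    then show "{(Q, U) \<in> space F. cube_point d A \<in> Q \<and> cube_point d B \<in> U} \<in> events"
      using E update_event [of "cube_point d B"] by simp
  qed simp
  have dist: "ell_dist s d (cube_point d A) (cube_point d (symdiff A D)) = real (card D) powr (1 / s)"
    if "A \<subseteq> ?I" "D \<subseteq> ?I" for A D
  proof -
    have "symdiff A D \<subseteq> ?I"
      using that by (auto simp: symdiff_def)
    then show ?thesis
      using that by (simp add: ell_dist_cube_point)
  qed
  have p: "0 < p\<^sub>1" "0 < p\<^sub>2"
    using sens by (auto simp: sensitive_family_def)
  have p1: "p\<^sub>1 \<le> prob (E A \<inter> E (symdiff A D))"
    if "A \<subseteq> ?I" "D \<subseteq> ?I" "real (card D) powr (1 / s) \<le> r" for A D
    using sens that unfolding sensitive_family_def joint [symmetric] by (simp add: dist)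
  have p2: "prob (E A \<inter> E (symdiff A D)) \<le> p\<^sub>2"
    if "A \<subseteq> ?I" "D \<subseteq> ?I" "R < real (card D) powr (1 / s)" for A D
    using sens that unfolding sensitive_family_def joint [symmetric] by (simp add: dist)
  have pq: "prob (E A) \<le> p\<^sub>q" for A
    using sens unfolding sensitive_family_def E_def by simp
  have bound: "\<kappa> A B \<le> p\<^sub>q ^ n" for A B
    unfolding \<kappa>_def by (intro power_mono order_trans [OF finite_measure_mono pq]) auto
  have "0 \<le> \<eta>'" "\<eta>' \<le> 1"
    using \<eta> \<eta>' C powr_le1 [of C "1 - 2 * \<eta>"] powr_ge_zero [of "1 - 2 * \<eta>" C] by linarith+
  have "p\<^sub>1 ^ n * measure_pmf.prob (binomial_pmf (card ?I) \<eta>) {k. real k powr (1 / s) \<le> r} \<le>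
      noise_stability ?I \<kappa> \<eta>"
    using \<eta> p p1 by (intro noise_stability_ge) (auto simp: \<kappa>_def intro: power_mono)
  then have "(p\<^sub>1 ^ n * measure_pmf.prob (binomial_pmf d \<eta>) {k. real k powr (1 / s) \<le> r}) powr C \<le>
      noise_stability ?I \<kappa> \<eta> powr C"
    using C p by (intro powr_mono2) auto
  also have "\<dots> \<le> (p\<^sub>q ^ n) powr (C - 1) * noise_stability ?I \<kappa> \<eta>'"
  proof (rule noise_stability_powr_le)
    show "psd_on (Pow ?I) \<kappa>"
      unfolding \<kappa>_def by (rule psd_on_prob_power) auto
  qed (use bound C \<eta> \<eta>' in auto)
  also have "noise_stability ?I \<kappa> \<eta>' \<le> p\<^sub>2 ^ n
      + p\<^sub>q ^ n * measure_pmf.prob (binomial_pmf (card ?I) \<eta>') {k. real k powr (1 / s) \<le> R}"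
    using \<open>0 \<le> \<eta>'\<close> \<open>\<eta>' \<le> 1\<close> p p2 bound
    by (intro noise_stability_le) (auto simp: \<kappa>_def intro: power_mono)
  finally show ?thesis
    by (simp add: mult_left_mono)
qed

section \<open>From the inequality to the ratio of logarithms\<close>

lemma log_ratio_ge:
  fixes p\<^sub>1 p\<^sub>2 p\<^sub>q \<delta> C :: real
  assumes p: "0 < p\<^sub>2" "p\<^sub>2 < p\<^sub>1" "p\<^sub>1 < p\<^sub>q" and C: "1 \<le> C" and \<delta>: "0 \<le> \<delta>" "\<delta> \<le> 1 / 2"
    and n: "(p\<^sub>2 / p\<^sub>q) ^ n \<le> 1 / 2"
    and le: "(p\<^sub>1 ^ n * (1 - \<delta>)) powr C \<le> (p\<^sub>q ^ n) powr (C - 1) * (p\<^sub>2 ^ n + p\<^sub>q ^ n * \<delta>)"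
  shows "1 / C - 6 * \<delta> / (p\<^sub>2 / p\<^sub>q) ^ n \<le> ln (p\<^sub>q / p\<^sub>1) / ln (p\<^sub>q / p\<^sub>2)"
proof -
  \<comment> \<open>After division by powers of \<open>p\<^sub>q ^ n\<close> and taking logarithms,
    the hypothesis says \<open>L \<le> C * X\<close> up to errors in \<delta>. The wanted ratio is
    \<open>X / L\<close>, where \<open>n\<close> cancels.\<close>
  define Q where "Q = (p\<^sub>2 / p\<^sub>q) ^ n"
  define L where "L = real n * ln (p\<^sub>q / p\<^sub>2)"
  define X where "X = real n * ln (p\<^sub>q / p\<^sub>1)"
  have Q: "0 < Q" "Q \<le> 1 / 2"
    using p n by (auto simp: Q_def)
  have "n > 0"
    using n by (cases n) auto
  have lnQ: "ln Q = - L"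
    using p by (simp add: Q_def L_def ln_realpow ln_div algebra_simps)
  \<comment> \<open>Here the amplification by \<open>n\<close> pays off: \<open>L\<close> stays away
    from 0, so dividing the errors by it is harmless.\<close>
  have "ln Q \<le> ln (1 / 2)"
    using Q by (subst ln_le_cancel_iff) auto
  then have L: "1 / 2 \<le> L"
    using lnQ ln2_ge_two_thirds by (simp add: ln_div)
  have "p\<^sub>2 ^ n + p\<^sub>q ^ n * \<delta> = p\<^sub>q ^ n * (Q + \<delta>)"
    using p by (simp add: Q_def field_simps)
  then have "ln ((p\<^sub>1 ^ n * (1 - \<delta>)) powr C) \<le> ln ((p\<^sub>q ^ n) powr (C - 1) * (p\<^sub>q ^ n * (Q + \<delta>)))"
    using le p \<delta> Q by (subst ln_le_cancel_iff) (auto intro!: mult_pos_pos add_pos_nonneg)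
  then have "C * (real n * ln p\<^sub>1 + ln (1 - \<delta>)) \<le>
      (C - 1) * (real n * ln p\<^sub>q) + (real n * ln p\<^sub>q + ln (Q + \<delta>))"
    using p \<delta> Q by (simp add: ln_mult ln_powr ln_realpow add_pos_nonneg)
  then have "C * ln (1 - \<delta>) - ln (Q + \<delta>) \<le> C * X"
    using p by (simp add: X_def ln_div algebra_simps)
  moreover have "ln (Q + \<delta>) \<le> - L + \<delta> / Q"
  proof -
    have "Q + \<delta> = Q * (1 + \<delta> / Q)"
      using Q by (simp add: field_simps)
    also have "ln \<dots> = ln Q + ln (1 + \<delta> / Q)"
      using Q \<delta> by (intro ln_mult_pos) (auto intro: add_pos_nonneg)
    finally show ?thesis
      using lnQ ln_add_one_self_le_self [of "\<delta> / Q"] Q \<delta> by simp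
  qed
  moreover have "- 2 * \<delta> \<le> ln (1 - \<delta>)"
  proof -
    have "\<delta>\<^sup>2 \<le> \<delta> / 2"
      using mult_left_mono [of \<delta> "1 / 2" \<delta>] \<delta> by (simp add: power2_eq_square)
    then show ?thesis
      using ln_one_minus_pos_lower_bound [of \<delta>] \<delta> by simp
  qed
  then have "C * (- 2 * \<delta>) \<le> C * ln (1 - \<delta>)"
    using C by (intro mult_left_mono) auto
  ultimately have "L - \<delta> / Q - 2 * C * \<delta> \<le> C * X"
    by simp
  then have "L / C - \<delta> / Q / C - 2 * \<delta> \<le> X"
    using C by (simp add: field_simps)
  moreover have "\<delta> / Q / C \<le> \<delta> / Q / 1"
    using Q \<delta> C by (intro divide_left_mono) auto
  moreover have "\<delta> \<le> \<delta> / Q"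
    using Q \<delta> mult_left_mono [of Q 1 \<delta>] by (simp add: pos_le_divide_eq)
  \<comment> \<open>All errors are at most \<open>3 * (\<delta> / Q)\<close> since
    \<open>C \<ge> 1\<close> and \<open>Q \<le> 1\<close>; dividing by \<open>L \<ge> 1 / 2\<close>
    doubles the 3 to the 6 of the claim.\<close>
  ultimately have "L / C - 3 * (\<delta> / Q) \<le> X"
    by linarith
  then have "1 / C - 3 * (\<delta> / Q) / L \<le> X / L"
    using L C by (simp add: field_simps)
  moreover have "3 * (\<delta> / Q) / L \<le> 3 * (\<delta> / Q) / (1 / 2)"
    using L Q \<delta> by (intro divide_left_mono) auto
  moreover have "X / L = ln (p\<^sub>q / p\<^sub>1) / ln (p\<^sub>q / p\<^sub>2)"
    using \<open>n > 0\<close> by (simp add: X_def L_def)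
  ultimately show ?thesis
    by (simp add: Q_def)
qed

section \<open>Calibrating the noise rates and the distance thresholds\<close>

lemma exp_minus_le_quadratic:
  fixes y :: real
  assumes "0 \<le> y"
  shows "exp (- y) \<le> 1 - y + y\<^sup>2 / 2"
proof -
  have pos: "0 \<le> 1 - y + y\<^sup>2 / 2"
    using zero_le_power2 [of "1 - y"] by (simp add: power2_eq_square algebra_simps)
  \<comment> \<open>The product of the two quadratics is at least 1, and the second is a lower bound
    for \<open>exp y\<close>.\<close>
  have "(1 - y + y\<^sup>2 / 2) * (1 + y + y\<^sup>2 / 2) = 1 + y ^ 4 / 4"
    by (simp add: power2_eq_square power4_eq_xxxx field_simps)
  moreover have "(1 - y + y\<^sup>2 / 2) * (1 + y + y\<^sup>2 / 2) \<le> (1 - y + y\<^sup>2 / 2) * exp y"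
    using pos exp_lower_Taylor_quadratic [OF assms] by (intro mult_left_mono) auto
  moreover have "0 \<le> y ^ 4 / 4"
    by simp
  ultimately have "1 \<le> (1 - y + y\<^sup>2 / 2) * exp y"
    by linarith
  then show ?thesis
    by (simp add: exp_minus field_simps)
qed

text \<open>To second order \<eta>' is at least
  \<open>C * \<eta> - ((C\<^sub>0 + 1) * \<eta>)\<^sup>2\<close>. This loss and the margins
  \<open>(C\<^sub>0 + 1) * \<eta>\<^sup>2\<close> for both tail bounds add up to exactly
  \<open>B * \<eta>\<^sup>2\<close>, which is what \<open>C\<close> gains over
  \<open>C\<^sub>0\<close>.\<close>

lemma flip_rate_gap:
  fixes C\<^sub>0 \<eta> :: real
  defines "B \<equiv> (C\<^sub>0 + 1) * (C\<^sub>0 + 2)"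
  assumes C\<^sub>0: "1 \<le> C\<^sub>0" and \<eta>: "0 < \<eta>" "\<eta> < 1 / 2" "B * \<eta> \<le> 1"
    and \<eta>': "1 - 2 * \<eta>' = (1 - 2 * \<eta>) powr (C\<^sub>0 + B * \<eta>)"
  shows "C\<^sub>0 * (\<eta> + \<eta>\<^sup>2) \<le> \<eta>' - \<eta>\<^sup>2"
proof -
  define C where "C = C\<^sub>0 + B * \<eta>"
  have B: "0 \<le> B"
    using C\<^sub>0 by (simp add: B_def)
  have C: "0 \<le> C" "C \<le> C\<^sub>0 + 1"
    using C\<^sub>0 \<eta> B by (auto simp: C_def)
  have "(1 - 2 * \<eta>) powr C \<le> exp (- (2 * \<eta>)) powr C"
    using \<eta> C exp_ge_add_one_self [of "- (2 * \<eta>)"] by (intro powr_mono2) auto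
  also have "\<dots> = exp (- (2 * C * \<eta>))"
    by (simp add: powr_def)
  also have "\<dots> \<le> 1 - 2 * C * \<eta> + (2 * C * \<eta>)\<^sup>2 / 2"
    using C \<eta> by (intro exp_minus_le_quadratic) auto
  also have "\<dots> = 1 - 2 * (C * \<eta> - (C * \<eta>)\<^sup>2)"
    by (simp add: power2_eq_square)
  finally have "C * \<eta> - (C * \<eta>)\<^sup>2 \<le> \<eta>'"
    using \<eta>' by (simp flip: C_def)
  moreover have "(C * \<eta>)\<^sup>2 \<le> ((C\<^sub>0 + 1) * \<eta>)\<^sup>2"
    using C \<eta> by (intro power_mono mult_right_mono) auto
  ultimately have "C * \<eta> - ((C\<^sub>0 + 1) * \<eta>)\<^sup>2 \<le> \<eta>'"
    by linarith
  then show ?thesis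
    by (simp add: C_def B_def power2_eq_square algebra_simps)
qed

text \<open>In terms of flips, the threshold exceeds the mean by \<open>\<eta>\<^sup>2 * d\<close>;
  Hoeffding's inequality for this deviation gives the exponent.\<close>

lemma binomial_tail_near:
  assumes "0 < d" "0 \<le> \<eta>" "\<eta> \<le> 1" "0 < s"
  shows "1 - exp (- 2 * \<eta> ^ 4 * real d) \<le>
    measure_pmf.prob (binomial_pmf d \<eta>) {k. real k powr (1 / s) \<le> ((\<eta> + \<eta>\<^sup>2) * real d) powr (1 / s)}"
    (is "_ \<le> measure_pmf.prob _ ?K")
proof -
  interpret binomial_distribution d \<eta>
    using assms by unfold_locales auto
  have "- ?K \<subseteq> {k. real d * \<eta> + \<eta>\<^sup>2 * real d \<le> real k}"
  proof
    fix k assume "k \<in> - ?K"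
    then show "k \<in> {k. real d * \<eta> + \<eta>\<^sup>2 * real d \<le> real k}"
      using assms powr_mono2 [of "1 / s" "real k" "(\<eta> + \<eta>\<^sup>2) * real d"]
      by (cases "real k \<le> (\<eta> + \<eta>\<^sup>2) * real d") (auto simp: algebra_simps)
  qed
  then have "measure_pmf.prob (binomial_pmf d \<eta>) (- ?K) \<le>
      measure_pmf.prob (binomial_pmf d \<eta>) {k. real d * \<eta> + \<eta>\<^sup>2 * real d \<le> real k}"
    by (intro measure_pmf.finite_measure_mono) auto
  also have "\<dots> \<le> exp (- 2 * (\<eta>\<^sup>2 * real d)\<^sup>2 / real d)"
    using assms by (intro prob_ge) auto
  also have "- 2 * (\<eta>\<^sup>2 * real d)\<^sup>2 / real d = - 2 * \<eta> ^ 4 * real d"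
    using assms by (simp add: power2_eq_square power4_eq_xxxx field_simps)
  finally show ?thesis
    using measure_pmf.prob_compl [of ?K "binomial_pmf d \<eta>"] by (simp add: Compl_eq_Diff_UNIV)
qed

text \<open>Raising to the power \<open>s\<close> turns the threshold into
  \<open>c powr s * t * d\<close> flips, at least \<open>\<eta>\<^sup>2 * d\<close> below the mean,
  so the same Hoeffding bound applies.\<close>

lemma binomial_tail_far:
  assumes "0 < d" "0 \<le> \<eta>'" "\<eta>' \<le> 1" "0 < s" "0 \<le> t" "0 \<le> c"
    and le: "c powr s * t \<le> \<eta>' - \<eta>\<^sup>2"
  shows "measure_pmf.prob (binomial_pmf d \<eta>') {k. real k powr (1 / s) \<le> c * (t * real d) powr (1 / s)}
    \<le> exp (- 2 * \<eta> ^ 4 * real d)"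
    (is "measure_pmf.prob _ ?K \<le> _")
proof -
  interpret binomial_distribution d \<eta>'
    using assms by unfold_locales auto
  have "?K \<subseteq> {k. real k \<le> real d * \<eta>' - \<eta>\<^sup>2 * real d}"
  proof
    fix k assume "k \<in> ?K"
    then have "(real k powr (1 / s)) powr s \<le> (c * (t * real d) powr (1 / s)) powr s"
      using assms by (intro powr_mono2) auto
    then have "real k \<le> c powr s * (t * real d)"
      using assms by (simp add: powr_mult powr_powr)
    also have "\<dots> \<le> (\<eta>' - \<eta>\<^sup>2) * real d"
      using mult_right_mono [OF le, of "real d"] by (simp add: mult.assoc)
    finally show "k \<in> {k. real k \<le> real d * \<eta>' - \<eta>\<^sup>2 * real d}"
      by (simp add: algebra_simps)
  qed
  then have "measure_pmf.prob (binomial_pmf d \<eta>') ?K \<le>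
      measure_pmf.prob (binomial_pmf d \<eta>') {k. real k \<le> real d * \<eta>' - \<eta>\<^sup>2 * real d}"
    by (intro measure_pmf.finite_measure_mono) auto
  also have "\<dots> \<le> exp (- 2 * (\<eta>\<^sup>2 * real d)\<^sup>2 / real d)"
    using assms by (intro prob_le) auto
  also have "- 2 * (\<eta>\<^sup>2 * real d)\<^sup>2 / real d = - 2 * \<eta> ^ 4 * real d"
    using assms by (simp add: power2_eq_square power4_eq_xxxx field_simps)
  finally show ?thesis .
qed

section \<open>The bound in a fixed dimension\<close>

lemma exists_power_le_half:
  fixes x :: real
  assumes "0 < x" "x < 1"
  obtains n where "x ^ n \<le> 1 / 2" "x / 2 \<le> x ^ n"
proof -
  define n where "n = (LEAST n. x ^ n \<le> 1 / 2)"
  have "\<exists>n. x ^ n < 1 / 2"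
    using assms by (intro real_arch_pow_inv) auto
  then have n: "x ^ n \<le> 1 / 2"
    unfolding n_def by (metis LeastI_ex less_imp_le)
  then obtain m where m: "n = Suc m"
    by (cases n) auto
  \<comment> \<open>Minimality of \<open>n\<close> keeps \<open>x ^ m\<close> above 1/2, so the
    amplified power is smaller than \<open>x\<close> by at most a factor 2.\<close>
  then have "m < (LEAST n. x ^ n \<le> 1 / 2)"
    unfolding n_def [symmetric] by simp
  then have "\<not> x ^ m \<le> 1 / 2"
    by (rule not_less_Least)
  then have "x / 2 \<le> x ^ n"
    using assms by (simp add: m)
  with n show ?thesis
    by (rule that)
qed

text \<open>The term \<open>B * \<eta>\<close> pays for replacing \<open>C\<^sub>0\<close> by the
  larger exponent \<open>C\<close>. The 12 is the 6 of \<open>log_ratio_ge\<close>, doubled because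
  the amplified power may be half of \<open>p\<^sub>2 / p\<^sub>q\<close>.\<close>

lemma sensitive_family_exponent_ge:
  fixes c s \<eta> :: real and d :: nat
  defines "C\<^sub>0 \<equiv> c powr s" and "r \<equiv> ((\<eta> + \<eta>\<^sup>2) * real d) powr (1 / s)"
    and "\<delta> \<equiv> exp (- 2 * \<eta> ^ 4 * real d)"
  defines "B \<equiv> (C\<^sub>0 + 1) * (C\<^sub>0 + 2)"
  assumes c: "1 < c" and s: "0 < s" and d: "0 < d" and \<eta>: "0 < \<eta>" "B * \<eta> \<le> 1"
    and \<delta>: "\<delta> \<le> 1 / 2"
    and sens: "sensitive_family (ell_space d) (ell_dist s d) F r (c * r) p\<^sub>1 p\<^sub>2 p\<^sub>q p\<^sub>u"
    and symm: "symmetric_family F"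
  shows "1 / C\<^sub>0 - B * \<eta> - 12 * \<delta> / (p\<^sub>2 / p\<^sub>q) \<le> ln (p\<^sub>q / p\<^sub>1) / ln (p\<^sub>q / p\<^sub>2)"
proof -
  define C where "C = C\<^sub>0 + B * \<eta>"
  define \<eta>' where "\<eta>' = (1 - (1 - 2 * \<eta>) powr C) / 2"
  have C\<^sub>0: "1 \<le> C\<^sub>0"
    unfolding C\<^sub>0_def using c s by (intro ge_one_powr_ge_zero) auto
  then have B: "6 \<le> B"
    using mult_mono [of 2 "C\<^sub>0 + 1" 3 "C\<^sub>0 + 2"] by (simp add: B_def)
  then have "6 * \<eta> \<le> B * \<eta>"
    using \<eta> by (intro mult_right_mono) auto
  then have \<eta>6: "\<eta> \<le> 1 / 6"
    using \<eta> by linarith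
  have C: "1 \<le> C" "C\<^sub>0 \<le> C"
    using C\<^sub>0 B \<eta> by (auto simp: C_def add_increasing2)
  have \<eta>': "1 - 2 * \<eta>' = (1 - 2 * \<eta>) powr C"
    by (simp add: \<eta>'_def field_simps)
  have \<eta>'01: "0 \<le> \<eta>'" "\<eta>' \<le> 1"
    using \<eta> \<eta>6 \<eta>' C powr_le1 [of C "1 - 2 * \<eta>"] powr_ge_zero [of "1 - 2 * \<eta>" C] by linarith+
  have p: "0 < p\<^sub>2" "p\<^sub>2 < p\<^sub>1" "p\<^sub>1 < p\<^sub>q"
    using sens by (auto simp: sensitive_family_def)
  then have q: "0 < p\<^sub>2 / p\<^sub>q" "p\<^sub>2 / p\<^sub>q < 1"
    by auto
  then obtain n where n: "(p\<^sub>2 / p\<^sub>q) ^ n \<le> 1 / 2" "p\<^sub>2 / p\<^sub>q / 2 \<le> (p\<^sub>2 / p\<^sub>q) ^ n"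
    by (rule exists_power_le_half)
  have near: "1 - \<delta> \<le> measure_pmf.prob (binomial_pmf d \<eta>) {k. real k powr (1 / s) \<le> r}"
    unfolding \<delta>_def r_def using d \<eta> \<eta>6 s by (intro binomial_tail_near) auto
  have "C\<^sub>0 * (\<eta> + \<eta>\<^sup>2) \<le> \<eta>' - \<eta>\<^sup>2"
    using flip_rate_gap [of C\<^sub>0 \<eta> \<eta>'] C\<^sub>0 \<eta> \<eta>6 \<eta>' by (simp add: B_def C_def)
  then have far: "measure_pmf.prob (binomial_pmf d \<eta>') {k. real k powr (1 / s) \<le> c * r} \<le> \<delta>"
    unfolding \<delta>_def r_def C\<^sub>0_def using d \<eta> \<eta>'01 s c by (intro binomial_tail_far) auto
  have "(p\<^sub>1 ^ n * (1 - \<delta>)) powr C \<le>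
      (p\<^sub>1 ^ n * measure_pmf.prob (binomial_pmf d \<eta>) {k. real k powr (1 / s) \<le> r}) powr C"
    using near p \<delta> C by (intro powr_mono2 mult_left_mono) auto
  also have "\<dots> \<le> (p\<^sub>q ^ n) powr (C - 1) *
      (p\<^sub>2 ^ n + p\<^sub>q ^ n * measure_pmf.prob (binomial_pmf d \<eta>') {k. real k powr (1 / s) \<le> c * r})"
    using \<eta> \<eta>6 by (intro sensitive_family_noise_bound [OF sens symm C(1) _ _ \<eta>']) auto
  also have "\<dots> \<le> (p\<^sub>q ^ n) powr (C - 1) * (p\<^sub>2 ^ n + p\<^sub>q ^ n * \<delta>)"
    using far p by (intro mult_left_mono add_left_mono) auto
  finally have "1 / C - 6 * \<delta> / (p\<^sub>2 / p\<^sub>q) ^ n \<le> ln (p\<^sub>q / p\<^sub>1) / ln (p\<^sub>q / p\<^sub>2)"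
    using p C \<delta> n by (intro log_ratio_ge) (auto simp: \<delta>_def)
  moreover have "6 * \<delta> / (p\<^sub>2 / p\<^sub>q) ^ n \<le> 6 * \<delta> / (p\<^sub>2 / p\<^sub>q / 2)"
    using n q by (intro divide_left_mono mult_pos_pos) (auto simp: \<delta>_def)
  moreover have "1 / C\<^sub>0 - B * \<eta> \<le> 1 / C"
  proof -
    have "1 / C\<^sub>0 - 1 / C = B * \<eta> / (C\<^sub>0 * C)"
      using C\<^sub>0 C by (simp add: C_def field_simps)
    also have "\<dots> \<le> B * \<eta> / 1"
      using C\<^sub>0 C B \<eta> mult_mono [of 1 C\<^sub>0 1 C] by (intro divide_left_mono) auto
    finally show ?thesis
      by simp
  qed
  ultimately show ?thesis
    by simp
qed

section \<open>Letting the dimension tend to infinity\<close>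

theorem theorem1p4:
  fixes c s :: real and q :: "nat \<Rightarrow> real"
  assumes "1 < c" and "0 < s"
    and "\<And>d. 0 < q d" and "\<And>d. q d < 1"
    and "\<exists>g. g \<in> o(\<lambda>d. real d) \<and> (\<forall>d. q d \<ge> 2 powr (- g d))"
  shows "\<exists>(r :: nat \<Rightarrow> real) (\<epsilon> :: nat \<Rightarrow> real).
    (\<forall>d. 0 < r d) \<and> filterlim r at_top sequentially \<and> \<epsilon> \<longlonglongrightarrow> 0 \<and>
    (\<forall>d p\<^sub>1 p\<^sub>2 p\<^sub>q p\<^sub>u F.
       sensitive_family (ell_space d) (ell_dist s d) F (r d) (c * r d) p\<^sub>1 p\<^sub>2 p\<^sub>q p\<^sub>u \<and>
       symmetric_family F \<and> p\<^sub>2 / p\<^sub>q = q d \<longrightarrow>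
       ln (p\<^sub>q / p\<^sub>1) / ln (p\<^sub>q / p\<^sub>2) \<ge> 1 / c powr s - \<epsilon> d)"
proof -
  \<comment> \<open>\<open>\<eta>\<close> is chosen so that the Hoeffding error \<open>exp (- 2 \<eta>\<^sup>4 d)\<close> equals \<open>exp (- 2 \<bar>g\<bar> - 2 \<surd>d)\<close>,
    negligible compared with \<open>q\<close>, while \<open>\<eta> \<longlonglongrightarrow> 0\<close>.\<close>
  obtain g where g: "g \<in> o(\<lambda>d. real d)" and q_ge: "\<And>d. q d \<ge> 2 powr (- g d)"
    using assms(5) by blast
  define B where "B = (c powr s + 1) * (c powr s + 2)"
  define u where "u d = (\<bar>g d\<bar> + sqrt (real d)) / real d" for d
  define \<eta> where "\<eta> d = sqrt (sqrt (u d))" for d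
  \<comment> \<open>In the finitely many dimensions where \<eta> is undefined or too large, the
    default \<epsilon> = 1 makes the claim trivial: the ratio is nonnegative and
    \<open>1 / c powr s \<le> 1\<close>.\<close>
  define good where "good d \<longleftrightarrow> 0 < d \<and> B * \<eta> d \<le> 1" for d
  define r where "r d = (if good d then ((\<eta> d + (\<eta> d)\<^sup>2) * real d) powr (1 / s) else 1)" for d
  define \<epsilon> where "\<epsilon> d = (if good d then B * \<eta> d + 12 * exp (- sqrt (real d)) else 1)" for d
  have C\<^sub>0: "1 \<le> c powr s"
    using assms by (intro ge_one_powr_ge_zero) auto
  then have B: "6 \<le> B"
    using mult_mono [of 2 "c powr s + 1" 3 "c powr s + 2"] by (simp add: B_def)
  have u_nonneg: "0 \<le> u d" for d
    by (simp add: u_def)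
  have \<eta>_pos: "0 < \<eta> d" if "0 < d" for d
    using that by (auto simp: \<eta>_def u_def intro!: divide_pos_pos add_nonneg_pos)
  have \<eta>4: "\<eta> d ^ 4 * real d = \<bar>g d\<bar> + sqrt (real d)" if "0 < d" for d
  proof -
    have "\<eta> d ^ 4 = ((\<eta> d)\<^sup>2)\<^sup>2"
      by simp
    also have "\<dots> = u d"
      using u_nonneg by (simp add: \<eta>_def)
    finally show ?thesis
      using that by (simp add: u_def)
  qed
  have "u \<longlonglongrightarrow> 0"
  proof -
    have "(\<lambda>d. \<bar>g d / real d\<bar> + sqrt (real d) / real d) \<longlonglongrightarrow> 0 + 0"
    proof (rule tendsto_add)
      show "(\<lambda>d. \<bar>g d / real d\<bar>) \<longlonglongrightarrow> 0"
        using smalloD_tendsto [OF g] by (rule tendsto_rabs_zero)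
      show "(\<lambda>d. sqrt (real d) / real d) \<longlonglongrightarrow> 0"
        by real_asymp
    qed
    then show ?thesis
      by (simp add: u_def [abs_def] add_divide_distrib)
  qed
  then have "(\<lambda>d. sqrt (sqrt (u d))) \<longlonglongrightarrow> sqrt (sqrt 0)"
    by (intro tendsto_real_sqrt)
  then have \<eta>_0: "\<eta> \<longlonglongrightarrow> 0"
    by (simp add: \<eta>_def [abs_def])
  have "(\<lambda>d. B * \<eta> d) \<longlonglongrightarrow> B * 0"
    by (intro tendsto_intros \<eta>_0)
  then have "eventually (\<lambda>d. B * \<eta> d < 1) sequentially"
    by (intro order_tendstoD(2)) auto
  then have good: "eventually good sequentially"
    using eventually_gt_at_top [of 0] by eventually_elim (simp add: good_def)
  have \<eta>_le_1: "\<eta> d \<le> 1" if "good d" for d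
  proof -
    have "1 * \<eta> d \<le> B * \<eta> d"
      using B u_nonneg [of d] by (intro mult_right_mono) (auto simp: \<eta>_def)
    with that show ?thesis
      by (simp add: good_def)
  qed
  show ?thesis
  proof (rule exI [of _ r], rule exI [of _ \<epsilon>], intro conjI allI impI)
    show "0 < r d" for d
      using \<eta>_pos [of d] add_pos_pos [of "\<eta> d" "(\<eta> d)\<^sup>2"] by (auto simp: r_def good_def)
    show "filterlim r at_top sequentially"
    proof (rule filterlim_at_top_mono)
      show "filterlim (\<lambda>d. sqrt (real d) powr (1 / s)) at_top sequentially"
        using \<open>0 < s\<close> by real_asymp
      \<comment> \<open>As \<eta> is at most 1, it dominates its fourth power, and
        \<open>\<eta> d ^ 4 * real d\<close> contains the summand \<open>sqrt (real d)\<close>,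
        which drives the growth of \<open>r\<close>.\<close>
      show "eventually (\<lambda>d. sqrt (real d) powr (1 / s) \<le> r d) sequentially"
        using good
      proof eventually_elim
        case (elim d)
        then have d: "0 < d"
          by (simp add: good_def)
        have "sqrt (real d) \<le> \<eta> d ^ 4 * real d"
          using \<eta>4 [OF d] by simp
        also have "\<dots> \<le> (\<eta> d + (\<eta> d)\<^sup>2) * real d"
          using power_decreasing [of 1 4 "\<eta> d"] \<eta>_le_1 [OF elim] \<eta>_pos [OF d]
          by (intro mult_right_mono) (auto intro: add_increasing2)
        finally show ?case
          using elim \<open>0 < s\<close> by (auto simp: r_def intro: powr_mono2)
      qed
    qed
    show "\<epsilon> \<longlonglongrightarrow> 0"
    proof (rule Lim_transform_eventually)
      have "(\<lambda>d. exp (- sqrt (real d))) \<longlonglongrightarrow> 0"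
        by real_asymp
      then have "(\<lambda>d. B * \<eta> d + 12 * exp (- sqrt (real d))) \<longlonglongrightarrow> B * 0 + 12 * 0"
        by (intro tendsto_intros \<eta>_0)
      then show "(\<lambda>d. B * \<eta> d + 12 * exp (- sqrt (real d))) \<longlonglongrightarrow> 0"
        by simp
      show "eventually (\<lambda>d. B * \<eta> d + 12 * exp (- sqrt (real d)) = \<epsilon> d) sequentially"
        using good by eventually_elim (simp add: \<epsilon>_def)
    qed
    fix d p\<^sub>1 p\<^sub>2 p\<^sub>q p\<^sub>u F
    assume *: "sensitive_family (ell_space d) (ell_dist s d) F (r d) (c * r d) p\<^sub>1 p\<^sub>2 p\<^sub>q p\<^sub>u \<and>
      symmetric_family F \<and> p\<^sub>2 / p\<^sub>q = q d"
    show "1 / c powr s - \<epsilon> d \<le> ln (p\<^sub>q / p\<^sub>1) / ln (p\<^sub>q / p\<^sub>2)"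
    proof (cases "good d")
      case True
      then have d: "0 < d" and B\<eta>: "B * \<eta> d \<le> 1"
        by (auto simp: good_def)
      define \<delta> where "\<delta> = exp (- 2 * \<eta> d ^ 4 * real d)"
      have \<delta>: "\<delta> = exp (- 2 * \<bar>g d\<bar> - 2 * sqrt (real d))"
        using \<eta>4 [OF d] by (simp add: \<delta>_def mult.assoc)
      have "1 \<le> sqrt (real d)"
        using d by simp
      then have "- 2 * \<bar>g d\<bar> - 2 * sqrt (real d) \<le> - 1"
        by linarith
      then have "\<delta> \<le> exp (- 1)"
        unfolding \<delta> by (subst exp_le_cancel_iff)
      also have "\<dots> \<le> (1 / 2 :: real)"
        using exp_ge_add_one_self [of 1] by (simp add: exp_minus field_simps)
      finally have "1 / c powr s - B * \<eta> d - 12 * \<delta> / (p\<^sub>2 / p\<^sub>q) \<le> ln (p\<^sub>q / p\<^sub>1) / ln (p\<^sub>q / p\<^sub>2)"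
        using * assms d B\<eta> \<eta>_pos [OF d] True unfolding B_def \<delta>_def
        by (intro sensitive_family_exponent_ge [of c s d "\<eta> d" F _ _ _ p\<^sub>u]) (auto simp: r_def)
      \<comment> \<open>Since \<open>ln 2 < 1\<close>, \<open>q d\<close> is at least
        \<open>exp (- \<bar>g d\<bar>)\<close>, so half of the term
        \<open>2 * \<bar>g d\<bar>\<close> in the exponent of \<delta> absorbs the division.\<close>
      moreover have "\<delta> / q d \<le> exp (- sqrt (real d))"
      proof -
        have "exp (- \<bar>g d\<bar>) \<le> exp (- (g d * ln 2))"
        proof -
          have "g d * ln 2 \<le> \<bar>g d\<bar> * 1"
            using ln_2_less_1 by (intro mult_mono) auto
          then show ?thesis
            by simp
        qed
        also have "\<dots> \<le> q d"
          using q_ge [of d] by (simp add: powr_def)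
        finally have "\<delta> / q d \<le> \<delta> / exp (- \<bar>g d\<bar>)"
          by (intro divide_left_mono) (auto simp: \<delta> assms)
        also have "\<dots> = exp (- \<bar>g d\<bar> - 2 * sqrt (real d))"
          by (simp add: \<delta> flip: exp_diff)
        also have "\<dots> \<le> exp (- sqrt (real d))"
          using abs_ge_zero [of "g d"] real_sqrt_ge_zero [of "real d"]
          by (subst exp_le_cancel_iff) linarith
        finally show ?thesis .
      qed
      ultimately show ?thesis
        using * True by (simp add: \<epsilon>_def)
    next
      case False
      have "0 \<le> ln (p\<^sub>q / p\<^sub>1) / ln (p\<^sub>q / p\<^sub>2)"
        using * by (intro divide_nonneg_nonneg ln_ge_zero) (auto simp: sensitive_family_def)
      moreover have "1 / c powr s \<le> 1"
        using C\<^sub>0 by (subst divide_le_eq_1_pos) linarith+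
      ultimately show ?thesis
        using False by (simp add: \<epsilon>_def)
    qed
  qed
qed

end
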